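(* Let $m,n\ge 0$ be integers and let $T_{m,n}$ be the square torus grid of dimension $(4m+2)\times(4n+2)$, i.e. the set of cells $\mathbb{Z}/(4m+2)\mathbb{Z}\times\mathbb{Z}/(4n+2)\mathbb{Z}$. Then $T_{m,n}$ cannot be tiled by T-tetrominoes.
   Context: The T-tetromino is the polyomino $\{(0,0),(0,1),(0,2),(1,1)\}\subset\mathbb{Z}^2$ (three unit squares in a row with a fourth square attached to the middle one). A placement of a polyomino $P\subset\mathbb{Z}^2$ on the torus grid is the image of $g(P)+v$ under the reduction map $\mathbb{Z}^2\to\mathbb{Z}/(4m+2)\mathbb{Z}\times\mathbb{Z}/(4n+2)\mathbb{Z}$, where $g$ is a rotation or reflection of the square lattice (an element of the dihedral group of order 8 acting on $\mathbb{Z}^2$) and $v\in\mathbb{Z}^2$, provided that this image consists of $|P|$ distinct cells. A tiling of the torus grid by a polyomino is a collection of placements of that polyomino whose cell sets partition the set of all cells. *)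

theory Defs
  imports Main "HOL-Library.Disjoint_Sets"
begin

type_synonym cell = "int \<times> int"

text \<open>The torus grid \<open>\<int>/a\<int> \<times> \<int>/b\<int>\<close>, with each residue class represented by its least
  nonnegative element (meaningful for \<open>a, b > 0\<close>).\<close>

definition torus_grid :: "int \<Rightarrow> int \<Rightarrow> cell set" where
  "torus_grid a b = {0..<a} \<times> {0..<b}"

definition torus_reduce :: "int \<Rightarrow> int \<Rightarrow> cell \<Rightarrow> cell" where
  "torus_reduce a b = (\<lambda>(x, y). (x mod a, y mod b))"

definition lattice_rot :: "cell \<Rightarrow> cell" where
  "lattice_rot = (\<lambda>(x, y). (- y, x))"

definition lattice_refl :: "cell \<Rightarrow> cell" where
  "lattice_refl = (\<lambda>(x, y). (x, - y))"

definition lattice_dihedral :: "(cell \<Rightarrow> cell) set" where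
  "lattice_dihedral = {(lattice_rot ^^ i) \<circ> (lattice_refl ^^ j) | i j. i < 4 \<and> j < 2}"

definition lattice_translate :: "cell \<Rightarrow> cell \<Rightarrow> cell" where
  "lattice_translate = (\<lambda>(u, v) (x, y). (x + u, y + v))"

definition torus_placements :: "int \<Rightarrow> int \<Rightarrow> cell set \<Rightarrow> cell set set" where
  "torus_placements a b P =
    {Q. \<exists>g \<in> lattice_dihedral. \<exists>v.
       Q = torus_reduce a b ` lattice_translate v ` g ` P \<and> card Q = card P}"

definition torus_tiling :: "int \<Rightarrow> int \<Rightarrow> cell set \<Rightarrow> cell set set \<Rightarrow> bool" where
  "torus_tiling a b P C \<longleftrightarrow>
     C \<subseteq> torus_placements a b P \<and> partition_on (torus_grid a b) C"

definition T_tetromino :: "cell set" where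
  "T_tetromino = {(0, 0), (0, 1), (0, 2), (1, 1)}"

end

theory Submission
  imports Defs
begin

text \<open>Both side lengths are even, so the checkerboard colouring of the plane descends to the torus
  and splits its cells evenly. Giving the two colours the values \<open>1\<close> and \<open>-1\<close>, the torus has sum
  \<open>0\<close>, while each T-tetromino has three cells of one colour and one of the other, hence sum \<open>\<plusminus>2\<close>.
  The number of tiles is therefore even; but it equals \<open>(2m + 1)(2n + 1)\<close>.\<close>

definition checkerboard :: "cell \<Rightarrow> int" where
  "checkerboard = (\<lambda>(x, y). if even (x + y) then 1 else - 1)"

lemma checkerboard_torus_reduce:
  assumes "even a" "even b"
  shows "checkerboard (torus_reduce a b c) = checkerboard c"
  using assms by (auto simp: checkerboard_def torus_reduce_def dvd_mod_iff split: prod.splits)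

text \<open>Parity of the coordinate sum is additive, so \<open>checkerboard\<close> is a
  homomorphism from the lattice to the group of signs.\<close>

lemma checkerboard_lattice_translate:
  "checkerboard (lattice_translate v c) = checkerboard v * checkerboard c"
  by (auto simp: checkerboard_def lattice_translate_def split: prod.splits)

text \<open>Both generators only permute coordinates and change signs, which preserves the parity of
  \<open>x + y\<close>.\<close>

lemma checkerboard_lattice_dihedral:
  assumes "g \<in> lattice_dihedral"
  shows "checkerboard (g c) = checkerboard c"
proof -
  have rot: "checkerboard ((lattice_rot ^^ i) c) = checkerboard c" for i c
    by (induction i) (auto simp: checkerboard_def lattice_rot_def split: prod.splits)
  have refl: "checkerboard ((lattice_refl ^^ j) c) = checkerboard c" for j c
    by (induction j) (auto simp: checkerboard_def lattice_refl_def split: prod.splits)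
  show ?thesis
    using assms by (auto simp: lattice_dihedral_def rot refl)
qed

text \<open>Of the whole motion only the translation can affect colours, and it does so by one
  global sign \<open>checkerboard v\<close>.\<close>

lemma sum_checkerboard_placement:
  assumes "even a" "even b" "finite P" "Q \<in> torus_placements a b P"
  obtains v where "sum checkerboard Q = checkerboard v * sum checkerboard P"
proof -
  obtain g v where g: "g \<in> lattice_dihedral"
    and Q: "Q = torus_reduce a b ` lattice_translate v ` g ` P" and card: "card Q = card P"
    using assms(4) by (auto simp: torus_placements_def)
  define f where "f = (\<lambda>c. torus_reduce a b (lattice_translate v (g c)))"
  have Qf: "Q = f ` P"
    by (simp add: Q f_def image_image)
  \<comment> \<open>The cardinality condition on placements rules out cells of \<open>P\<close>
    merging on the torus, so the sum may be reindexed over \<open>P\<close>.\<close>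
  have "inj_on f P"
    using card \<open>finite P\<close> by (simp add: Qf eq_card_imp_inj_on)
  then have "sum checkerboard Q = (\<Sum>c\<in>P. checkerboard (f c))"
    by (simp add: Qf sum.reindex)
  also have "\<dots> = checkerboard v * sum checkerboard P"
    using assms(1,2) g
    by (simp add: f_def checkerboard_torus_reduce checkerboard_lattice_translate
        checkerboard_lattice_dihedral sum_distrib_left)
  finally show thesis
    using that by blast
qed

text \<open>The colour is a product of one sign per coordinate, so the sum factors; the factor of
  the second coordinate cancels in pairs of consecutive integers.\<close>

lemma sum_checkerboard_torus_grid:
  assumes "even b"
  shows "sum checkerboard (torus_grid a b) = 0"
proof -
  define s :: "int \<Rightarrow> int" where "s = (\<lambda>y. if even y then 1 else - 1)"
  have s: "sum s {0..<2 * int k} = 0" for k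
  proof (induction k)
    case (Suc k)
    have "{0..<2 * int (Suc k)} = insert (2 * int k + 1) (insert (2 * int k) {0..<2 * int k})"
      by auto
    then show ?case
      using Suc by (simp add: s_def)
  qed simp
  have "sum s {0..<b} = 0"
  proof (cases "b \<ge> 0")
    case True
    then obtain k where "b = 2 * int k"
      using assms by (metis evenE nonneg_int_cases zero_le_mult_iff zero_less_numeral not_le)
    then show ?thesis
      using s by simp
  qed simp
  moreover have "checkerboard (x, y) = s x * s y" for x y
    by (simp add: checkerboard_def s_def)
  ultimately show ?thesis
    unfolding torus_grid_def
    by (simp add: sum.cartesian_product' flip: sum_distrib_left)
qed

theorem theorem3p2:
  fixes m n :: nat
  shows "\<not> (\<exists>C. torus_tiling (4 * int m + 2) (4 * int n + 2) T_tetromino C)"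
proof
  define a b where "a = 4 * int m + 2" and "b = 4 * int n + 2"
  have ev: "even a" "even b"
    by (simp_all add: a_def b_def)
  assume "\<exists>C. torus_tiling (4 * int m + 2) (4 * int n + 2) T_tetromino C"
  then obtain C where placed: "C \<subseteq> torus_placements a b T_tetromino"
    and part: "partition_on (torus_grid a b) C"
    by (auto simp: torus_tiling_def a_def b_def)
  have fin: "finite (torus_grid a b)"
    by (simp add: torus_grid_def)
  have Un: "torus_grid a b = \<Union>C" and disj: "\<forall>A\<in>C. \<forall>B\<in>C. A \<noteq> B \<longrightarrow> A \<inter> B = {}"
    using part by (auto simp: partition_on_def disjoint_def)
  have finC: "finite C" and finQ: "\<forall>Q\<in>C. finite Q"
    using fin unfolding Un by (auto intro: finite_UnionD finite_subset)
  \<comment> \<open>Kept general in \<open>f\<close> to serve twice: the constant \<open>1\<close>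
    counts cells, \<open>checkerboard\<close> weighs colours.\<close>
  have sum_grid: "sum f (torus_grid a b) = (\<Sum>Q\<in>C. sum f Q)" for f :: "cell \<Rightarrow> int"
    unfolding Un using sum.Union_disjoint[OF finQ disj] by simp

  have "card Q = 4" if "Q \<in> C" for Q
    using that placed by (auto simp: torus_placements_def T_tetromino_def)
  then have "4 * int (card C) = a * b"
    using sum_grid[of "\<lambda>_. 1"] by (simp add: torus_grid_def a_def b_def)
  then have "int (card C) = (2 * int m + 1) * (2 * int n + 1)"
    by (simp add: a_def b_def algebra_simps)
  then have "odd (int (card C))"
    by (metis even_mult_iff even_plus_one_iff dvd_triv_left)

  \<comment> \<open>Modulo 4 the two possible values \<open>2\<close> and \<open>-2\<close> agree,
    so the sign of the placement drops out.\<close>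
  have "sum checkerboard Q mod 4 = 2" if "Q \<in> C" for Q
  proof -
    have "sum checkerboard T_tetromino = 2"
      by (simp add: T_tetromino_def checkerboard_def)
    moreover have "finite T_tetromino"
      by (simp add: T_tetromino_def)
    moreover have "Q \<in> torus_placements a b T_tetromino"
      using that placed by blast
    ultimately obtain v where "sum checkerboard Q = checkerboard v * 2"
      using sum_checkerboard_placement[OF ev] by metis
    then show ?thesis
      by (auto simp: checkerboard_def split: prod.splits if_splits)
  qed
  then have "(\<Sum>Q\<in>C. sum checkerboard Q) mod 4 = (\<Sum>Q\<in>C. 2) mod 4"
    by (subst mod_sum_eq[symmetric]) simp
  moreover have "(\<Sum>Q\<in>C. sum checkerboard Q) = 0"
    using sum_checkerboard_torus_grid[OF ev(2), of a] by (simp add: sum_grid)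
  \<comment> \<open>The colour sum of the grid is \<open>0\<close>, yet modulo 4 it is
    \<open>2\<close> per tile.\<close>
  ultimately have "4 dvd 2 * int (card C)"
    by (simp add: mult.commute mod_eq_0_iff_dvd)
  then have "even (int (card C))"
    by presburger
  with \<open>odd (int (card C))\<close> show False
    by blast
qed

end
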